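(* Let $F(x)\in\mathbb{Z}_{\geq 0}[x]$ be a polynomial with $\deg F\geq 1$ and $F(0)=1$, and let $(x_n)_{n\geq 0}$ be the sequence generated from the initial values $x_0=x_1=1$ by the recurrence $$x_{n+2}\,x_n = x_{n+1}^2\,F(x_{n+1}),\qquad n\geq 0.$$ For $n\geq 0$ set $$a_{2n}=x_n,\qquad a_{2n+1}=\frac{F(x_{n+1})-1}{x_n}.$$ Then the infinite sum of the reciprocals of the terms of the sequence is given by the infinite continued fraction $$S_\infty=\sum_{j=1}^\infty \frac{1}{x_j}=[a_0;a_1,a_2,\ldots,a_n,\ldots].$$
   Context: $\mathbb{Z}_{\geq 0}[x]$ denotes the set of polynomials with non-negative integer coefficients. Since $F(x)>0$ for $x>0$, all $x_n$ are positive and the recurrence is well defined. The coefficients $a_n$ are positive integers. The notation for finite continued fractions is $$[a_0;a_1,a_2,\ldots,a_n]=a_0+\cfrac{1}{a_1+\cfrac{1}{a_2+\cdots+\cfrac{1}{a_n}}},$$ and $[a_0;a_1,a_2,\ldots,a_n,\ldots]$ denotes the limit of $[a_0;a_1,\ldots,a_n]$ as $n\to\infty$. *)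

theory Defs
  imports Complex_Main "HOL-Computational_Algebra.Polynomial"
begin

text \<open>
  \<open>cfrac_upto a n\<close> is the finite continued fraction \<open>[a 0; a 1, \<dots>, a n]\<close>, unfolded from the
  left: \<open>[a 0; a 1, \<dots>, a (n + 1)] = a 0 + 1 / [a 1; a 2, \<dots>, a (n + 1)]\<close>. It takes its usual
  meaning when \<open>a k > 0\<close> for all \<open>k \<ge> 1\<close>, since then no denominator is zero.
\<close>

primrec cfrac_upto :: "(nat \<Rightarrow> real) \<Rightarrow> nat \<Rightarrow> real" where
  "cfrac_upto a 0 = a 0"
| "cfrac_upto a (Suc n) = a 0 + 1 / cfrac_upto (\<lambda>k. a (Suc k)) n"

end

theory Submission imports Defs begin

text \<open>
  With \<open>p n / q n\<close> the convergents of the continued fraction, the recurrence for \<open>x\<close> gives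
  \<open>q (2 * n) = x (n + 1)\<close> and \<open>q (2 * n + 1) = x (n + 2) / x (n + 1) - 1\<close>. By the determinant
  formula consecutive even convergents then differ by \<open>a (2 * n + 2) / (q (2 * n) * q (2 * n + 2)) =
  1 / x (n + 2)\<close>, so the even convergents are the partial sums of the series; as
  \<open>x (n + 2) \<ge> 2 * x (n + 1)\<close>, the series converges and the odd convergents have the same limit.
\<close>

text \<open>The classical continuant recurrence; the usual starting values p(-1) = 1 and q(-1) = 0
  are absorbed into the case \<open>Suc 0\<close> here and in \<open>cf_den\<close>.\<close>

fun cf_num :: "(nat \<Rightarrow> real) \<Rightarrow> nat \<Rightarrow> real" where
  "cf_num a 0 = a 0"
| "cf_num a (Suc 0) = a 1 * a 0 + 1"
| "cf_num a (Suc (Suc n)) = a (n + 2) * cf_num a (Suc n) + cf_num a n"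

fun cf_den :: "(nat \<Rightarrow> real) \<Rightarrow> nat \<Rightarrow> real" where
  "cf_den a 0 = 1"
| "cf_den a (Suc 0) = a 1"
| "cf_den a (Suc (Suc n)) = a (n + 2) * cf_den a (Suc n) + cf_den a n"

text \<open>Both sides obey the same three-term recurrence with the same first two values. Together
  with \<open>cf_num_Suc\<close> this reconciles \<open>cfrac_upto\<close>, which unfolds from the
  left, with the recurrence, which appends terms on the right.\<close>

lemma cf_den_Suc: "cf_den a (Suc n) = cf_num (\<lambda>k. a (Suc k)) n"
  by (induction a n rule: cf_num.induct) auto

lemma cf_num_Suc:
  "cf_num a (Suc n) = a 0 * cf_num (\<lambda>k. a (Suc k)) n + cf_den (\<lambda>k. a (Suc k)) n"
  by (induction a n rule: cf_num.induct) (auto simp: algebra_simps)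

lemma cf_num_pos:
  assumes "\<And>k. a k > 0"
  shows "cf_num a n > 0"
  using assms by (induction a n rule: cf_num.induct) (auto intro!: add_pos_pos mult_pos_pos)

lemma cf_den_pos:
  assumes "\<And>k. a (Suc k) > 0"
  shows "cf_den a n > 0"
  using assms cf_num_pos[of "\<lambda>k. a (Suc k)"] by (cases n) (auto simp: cf_den_Suc)

lemma cfrac_upto_eq:
  assumes "\<And>k. a (Suc k) > 0"
  shows "cfrac_upto a n = cf_num a n / cf_den a n"
  using assms
proof (induction n arbitrary: a)
  case (Suc n)
  have "cf_num (\<lambda>k. a (Suc k)) n > 0"
    using Suc.prems by (intro cf_num_pos)
  then show ?case
    using Suc.IH[of "\<lambda>k. a (Suc k)"] Suc.prems
    by (simp add: cf_den_Suc cf_num_Suc add_divide_distrib)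
qed simp

lemma cf_determinant:
  "cf_num a (Suc n) * cf_den a n - cf_num a n * cf_den a (Suc n) = (-1) ^ n"
proof (induction n)
  case (Suc n)
  then show ?case by (simp add: algebra_simps)
qed simp

lemma cfrac_upto_Suc_diff:
  assumes "\<And>k. a (Suc k) > 0"
  shows "cfrac_upto a (Suc n) - cfrac_upto a n = (-1) ^ n / (cf_den a n * cf_den a (Suc n))"
  using cf_den_pos[of a n] cf_den_pos[of a "Suc n"] assms cf_determinant[of a n]
  by (simp add: cfrac_upto_eq field_simps del: cfrac_upto.simps)

text \<open>Two consecutive one-step differences have opposite signs; over a common denominator they
  leave q(n + 2) - q(n) = a(n + 2) q(n + 1), and the middle denominator q(n + 1) cancels.\<close>

lemma cfrac_upto_Suc_Suc_diff:
  assumes "\<And>k. a (Suc k) > 0"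
  shows "cfrac_upto a (Suc (Suc n)) - cfrac_upto a n
    = (-1) ^ n * a (n + 2) / (cf_den a n * cf_den a (Suc (Suc n)))"
proof -
  have pos: "cf_den a n > 0" "cf_den a (Suc n) > 0" "cf_den a (Suc (Suc n)) > 0"
    using assms by (intro cf_den_pos; blast)+
  have "cfrac_upto a (Suc (Suc n)) - cfrac_upto a n
      = (-1) ^ n / (cf_den a n * cf_den a (Suc n))
        - (-1) ^ n / (cf_den a (Suc n) * cf_den a (Suc (Suc n)))"
    using cfrac_upto_Suc_diff[of a n] cfrac_upto_Suc_diff[of a "Suc n"] assms
    by (simp del: cfrac_upto.simps cf_den.simps)
  also have "\<dots> = (-1) ^ n * (cf_den a (Suc (Suc n)) - cf_den a n)
      / (cf_den a n * cf_den a (Suc n) * cf_den a (Suc (Suc n)))"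
    using pos by (simp add: divide_simps del: cf_den.simps) (simp add: algebra_simps del: cf_den.simps)
  also have "cf_den a (Suc (Suc n)) - cf_den a n = a (n + 2) * cf_den a (Suc n)"
    by simp
  finally show ?thesis
    using pos by (simp add: divide_simps del: cf_den.simps)
qed

text \<open>The constant term is 1 and the leading term is at least 1, its coefficient being a
  positive integer. They are different terms since the degree is positive, and all others are
  nonnegative.\<close>

lemma poly_ge_2:
  fixes F :: "int poly" and t :: real
  assumes nonneg: "\<And>i. coeff F i \<ge> 0" and deg: "degree F \<ge> 1" and F0: "poly F 0 = 1"
    and t: "t \<ge> 1"
  shows "poly (map_poly real_of_int F) t \<ge> 2"
proof -
  let ?G = "map_poly real_of_int F"
  have coeff_G: "coeff ?G i = real_of_int (coeff F i)" for i
    by (simp add: coeff_map_poly)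
  have "lead_coeff F \<noteq> 0"
    using deg by auto
  then have "lead_coeff F \<ge> 1"
    using nonneg[of "degree F"] by linarith
  then have "1 * 1 \<le> coeff ?G (degree F) * t ^ degree F"
    using t by (intro mult_mono) (auto simp: coeff_G)
  moreover have "coeff ?G 0 = 1"
    using F0 by (simp add: coeff_G poly_0_coeff_0)
  ultimately have "2 \<le> (\<Sum>i\<in>{0, degree F}. coeff ?G i * t ^ i)"
    using deg by simp
  also have "\<dots> \<le> (\<Sum>i\<le>degree F. coeff ?G i * t ^ i)"
    using nonneg t by (intro sum_mono2) (auto simp: coeff_G)
  also have "\<dots> = poly ?G t"
    by (simp add: poly_altdef degree_map_poly)
  finally show ?thesis .
qed

lemma LIMSEQ_even_odd:
  fixes f :: "nat \<Rightarrow> 'a::topological_space"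
  assumes even: "(\<lambda>n. f (2 * n)) \<longlonglongrightarrow> L" and odd: "(\<lambda>n. f (2 * n + 1)) \<longlonglongrightarrow> L"
  shows "f \<longlonglongrightarrow> L"
proof (rule topological_tendstoI)
  fix S assume S: "open S" "L \<in> S"
  obtain M N where MN: "\<And>n. n \<ge> M \<Longrightarrow> f (2 * n) \<in> S" "\<And>n. n \<ge> N \<Longrightarrow> f (2 * n + 1) \<in> S"
    using topological_tendstoD[OF even S] topological_tendstoD[OF odd S]
    unfolding eventually_sequentially by blast
  have "f n \<in> S" if n: "n \<ge> 2 * M + 2 * N + 1" for n
  proof (cases "even n")
    case True
    then show ?thesis using MN(1)[of "n div 2"] n by auto
  next
    case False
    then obtain k where k: "n = 2 * k + 1"
      by (elim oddE)
    then show ?thesis using MN(2)[of k] n by simp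
  qed
  then show "\<forall>\<^sub>F n in sequentially. f n \<in> S"
    unfolding eventually_sequentially by blast
qed

theorem corollary2p2:
  fixes F :: "int poly" and x a :: "nat \<Rightarrow> real"
  assumes F_nonneg: "\<And>i. coeff F i \<ge> 0"
    and F_deg: "degree F \<ge> 1"
    and F_0: "poly F 0 = 1"
    and x_0: "x 0 = 1"
    and x_1: "x 1 = 1"
    and x_rec: "\<And>n. x (n + 2) * x n = (x (n + 1))\<^sup>2 * poly (map_poly real_of_int F) (x (n + 1))"
    and a_even: "\<And>n. a (2 * n) = x n"
    and a_odd: "\<And>n. a (2 * n + 1) = (poly (map_poly real_of_int F) (x (n + 1)) - 1) / x n"
  shows "summable (\<lambda>j. 1 / x (j + 1)) \<and>
    (\<lambda>n. cfrac_upto a n) \<longlonglongrightarrow> (\<Sum>j. 1 / x (j + 1))"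
proof -
  let ?F = "poly (map_poly real_of_int F)"
  have F_ge_2: "?F t \<ge> 2" if "t \<ge> 1" for t
    using poly_ge_2[OF F_nonneg F_deg F_0 that] .
  \<comment> \<open>In the recurrence, bound F by 2 and one factor \<open>x (n + 1)\<close> by
    \<open>x n\<close>, then cancel \<open>x n\<close>. The bound is conditional because the
    induction for \<open>x_mono\<close> relies on it.\<close>
  have growth: "x (n + 2) \<ge> 2 * x (n + 1)" if "x n \<ge> 1" "x (n + 1) \<ge> x n" for n
  proof -
    have "2 * x (n + 1) * x n \<le> 2 * x (n + 1) * x (n + 1)"
      using that by (intro mult_left_mono) auto
    also have "\<dots> = (x (n + 1))\<^sup>2 * 2"
      by (simp add: power2_eq_square)
    also have "\<dots> \<le> (x (n + 1))\<^sup>2 * ?F (x (n + 1))"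
      using that by (intro mult_left_mono F_ge_2) auto
    also have "\<dots> = x (n + 2) * x n"
      by (simp only: x_rec)
    finally show ?thesis
      using that by simp
  qed
  have x_mono: "x n \<ge> 1 \<and> x (n + 1) \<ge> x n" for n
  proof (induction n)
    case (Suc n)
    then show ?case using growth[of n] by auto
  qed (use x_0 x_1 in simp)
  have x_double: "x (n + 2) \<ge> 2 * x (n + 1)" for n
    using growth x_mono by blast
  have x_pos: "x n > 0" for n
    using x_mono[of n] by linarith
  have x_ge: "x (n + 1) \<ge> 2 ^ n" for n
  proof (induction n)
    case (Suc n)
    then show ?case using x_double[of n] by simp
  qed (use x_1 in simp)
  have summable: "summable (\<lambda>j. 1 / x (j + 1))"
  proof (rule summable_comparison_test')
    show "summable (\<lambda>n. (1 / 2 :: real) ^ n)"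
      by (rule summable_geometric) simp
    show "norm (1 / x (n + 1)) \<le> (1 / 2) ^ n" for n
      using x_ge[of n] x_pos[of "n + 1"] by (simp add: power_divide frac_le)
  qed
  have a_pos: "a k > 0" for k
  proof (cases "even k")
    case True
    then show ?thesis using a_even x_pos by (auto elim: evenE)
  next
    case False
    then obtain n where "k = 2 * n + 1"
      by (elim oddE)
    moreover have "?F (x (n + 1)) \<ge> 2"
      using F_ge_2 x_mono by blast
    ultimately show ?thesis
      using a_odd[of n] x_pos[of n] by simp
  qed
  \<comment> \<open>The recurrence for the denominators couples the two parities, so both formulas
    go through one induction. In the even case the summand -1 of the odd formula, multiplied by
    \<open>x (n + 1)\<close>, cancels the previous even denominator.\<close>
  have den: "cf_den a (2 * n) = x (n + 1) \<and> cf_den a (2 * n + 1) = x (n + 2) / x (n + 1) - 1" for n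
  proof (induction n)
    case 0
    show ?case
      using a_odd[of 0] x_rec[of 0] x_0 x_1 by simp
  next
    case (Suc n)
    have pos: "x (n + 1) > 0" "x (n + 2) > 0"
      using x_pos by auto
    have even: "cf_den a (2 * Suc n) = x (n + 2)"
      using Suc a_even[of "n + 1"] pos by (simp add: field_simps)
    have "x (n + 3) * x (n + 1) = (x (n + 2))\<^sup>2 * ?F (x (n + 2))"
      using x_rec[of "n + 1"] by (simp add: eval_nat_numeral)
    \<comment> \<open>Read as a formula for the ratio of neighbours, the recurrence turns the F-term
      of the next odd denominator into the new ratio; the remaining terms
      \<open>x (n + 2) / x (n + 1)\<close> cancel.\<close>
    then have ratio: "x (n + 3) / x (n + 2) = x (n + 2) * ?F (x (n + 2)) / x (n + 1)"
      using pos by (simp add: field_simps power2_eq_square)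
    have "cf_den a (2 * Suc n + 1) = a (2 * (n + 1) + 1) * cf_den a (2 * Suc n) + cf_den a (2 * n + 1)"
      by simp
    also have "\<dots> = (?F (x (n + 2)) - 1) / x (n + 1) * x (n + 2) + (x (n + 2) / x (n + 1) - 1)"
      using Suc even a_odd[of "n + 1"] by simp
    also have "\<dots> = x (n + 3) / x (n + 2) - 1"
      unfolding ratio using pos by (simp add: field_simps)
    finally show ?case
      using even by (simp add: eval_nat_numeral)
  qed
  \<comment> \<open>There are n + 1 summands because the convergent of index 0 is already 1 =
    \<open>1 / x 1\<close>.\<close>
  have even_eq: "cfrac_upto a (2 * n) = (\<Sum>j<n + 1. 1 / x (j + 1))" for n
  proof (induction n)
    case 0
    show ?case using a_even[of 0] x_0 x_1 by simp
  next
    case (Suc n)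
    \<comment> \<open>The numerator \<open>x (n + 1)\<close> is \<open>a (2 * n + 2)\<close>; the
      equal factor below it is the denominator of index 2 n.\<close>
    have "cfrac_upto a (2 * Suc n) - cfrac_upto a (2 * n) = x (n + 1) / (x (n + 1) * x (n + 2))"
      using cfrac_upto_Suc_Suc_diff[of a "2 * n"] a_pos a_even[of "n + 1"] den[of n] den[of "n + 1"]
      by (simp del: cfrac_upto.simps cf_den.simps)
    also have "\<dots> = 1 / x (n + 2)"
      using x_pos[of "n + 1"] by simp
    finally show ?case
      using Suc by (simp del: cfrac_upto.simps)
  qed
  have even_lim: "(\<lambda>n. cfrac_upto a (2 * n)) \<longlonglongrightarrow> (\<Sum>j. 1 / x (j + 1))"
    unfolding even_eq using LIMSEQ_Suc[OF summable_LIMSEQ[OF summable]] by simp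
  \<comment> \<open>The gap is the reciprocal of two consecutive denominators. Doubling makes the
    odd one at least 1, so the gap is at most \<open>1 / x (n + 1)\<close>, a term of a convergent
    series.\<close>
  have "(\<lambda>n. cfrac_upto a (2 * n + 1) - cfrac_upto a (2 * n)) \<longlonglongrightarrow> 0"
  proof (rule tendsto_0_le)
    show "(\<lambda>n. 1 / x (n + 1)) \<longlonglongrightarrow> 0"
      using summable by (rule summable_LIMSEQ_zero)
    have "norm (cfrac_upto a (2 * n + 1) - cfrac_upto a (2 * n)) \<le> 1 / x (n + 1)" for n
    proof -
      have "x (n + 2) / x (n + 1) \<ge> 2"
        using x_double[of n] x_pos[of "n + 1"] by (simp add: pos_le_divide_eq)
      then have "cf_den a (2 * n + 1) \<ge> 1"
        using den[of n] by linarith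
      then have "x (n + 1) * 1 \<le> x (n + 1) * cf_den a (2 * n + 1)"
        using x_pos[of "n + 1"] by (intro mult_left_mono) auto
      then have "1 / (x (n + 1) * cf_den a (2 * n + 1)) \<le> 1 / x (n + 1)"
        using x_pos[of "n + 1"] by (intro divide_left_mono) (auto intro: mult_pos_pos)
      moreover have "cfrac_upto a (2 * n + 1) - cfrac_upto a (2 * n)
          = 1 / (x (n + 1) * cf_den a (2 * n + 1))"
        using cfrac_upto_Suc_diff[of a "2 * n"] a_pos den[of n]
        by (simp del: cfrac_upto.simps cf_den.simps)
      moreover have "x (n + 1) * cf_den a (2 * n + 1) > 0"
        using x_pos[of "n + 1"] \<open>cf_den a (2 * n + 1) \<ge> 1\<close> by (intro mult_pos_pos) auto
      ultimately show ?thesis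
        by simp
    qed
    then show "\<forall>\<^sub>F n in sequentially.
        norm (cfrac_upto a (2 * n + 1) - cfrac_upto a (2 * n)) \<le> norm (1 / x (n + 1)) * 1"
      using x_pos by (simp add: abs_of_pos)
  qed
  from tendsto_add[OF this even_lim]
  have "(\<lambda>n. cfrac_upto a (2 * n + 1)) \<longlonglongrightarrow> (\<Sum>j. 1 / x (j + 1))"
    by (simp del: cfrac_upto.simps)
  with even_lim summable show ?thesis
    by (blast intro: LIMSEQ_even_odd)
qed

end
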